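(* Let $R>0$ and let $p=\frac{p_0}{q_0}\ge 1$ where $p_0,q_0$ are positive integers, $p_0$ is even and $(p_0,q_0)=1$. For each positive integer $n$ let $$M_n=\{(x_1,\dots,x_n)\in\mathbb{R}^n : x_1^p+\cdots+x_n^p\le nR^p\},$$ and suppose that the point $(x_1,\dots,x_n)$ is taken in $M_n$ with equiprobability (i.e. uniformly distributed with respect to Lebesgue measure on $M_n$). Then: (1) The density of every coordinate $x_k$, as a random variable, is $$\rho_n(x_k)=\frac{p\,\Gamma(1+\frac{n}{p})}{2Rn^{\frac1p}\Gamma(\frac1p)\Gamma(1+\frac{n-1}{p})}\Bigl(1-\frac{x_k^p}{nR^p}\Bigr)^{\frac{n-1}{p}}$$ for $x_k^p\le nR^p$ (and $0$ otherwise), and its limit as $n\to\infty$ is $$\rho(x)=\frac{1}{2R\,\Gamma(\frac1p)\,p^{\frac1p-1}}\,e^{-\frac{x^p}{pR^p}},\qquad x\in(-\infty,+\infty).$$ (2) In general, for any $k$ distinct coordinates $x_{i_1},\dots,x_{i_k}$ with $\{i_1,\dots,i_k\}\subset\{1,\dots,n\}$, their joint density is $$\rho_n(x_{i_1},\dots,x_{i_k})=\frac{p^k\,\Gamma(1+\frac np)}{2^kR^kn^{\frac kp}\Gamma^k(\frac1p)\Gamma(1+\frac{n-k}{p})}\Bigl(1-\frac{x_{i_1}^p+\cdots+x_{i_k}^p}{nR^p}\Bigr)^{\frac{n-k}{p}}$$ for $x_{i_1}^p+\cdots+x_{i_k}^p\le nR^p$ (and $0$ otherwise), and, for fixed $k$,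 its limit as $n\to\infty$ is $$\rho(x_{i_1},\dots,x_{i_k})=\frac{1}{2^kR^k\Gamma^k(\frac1p)p^{\frac kp-k}}\,e^{-\frac{x_{i_1}^p+\cdots+x_{i_k}^p}{pR^p}},\qquad x_{i_j}\in(-\infty,+\infty),\ j=1,\dots,k,$$ that is, $\rho(x_{i_1},\dots,x_{i_k})=\rho(x_{i_1})\cdots\rho(x_{i_k})$; so in the limit $n\to\infty$ any finitely many coordinates of a point of $M_n$, as random variables, are independent (the limiting joint density is the product of the limiting marginal densities).
   Context: Since $p_0$ is even and coprime to $q_0$ (so $q_0$ is odd), $x^p=(x^{p_0})^{1/q_0}$ is defined for all real $x$ and equals $|x|^p$. $\Gamma$ is the Gamma function and $\Gamma^k(a)=(\Gamma(a))^k$. *)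

theory Defs
  imports "HOL-Probability.Probability"
begin

text \<open>
  For even \<open>a\<close> and odd \<open>b\<close> this is \<open>x\<close> to the rational power \<open>a/b\<close>, which makes sense for
  every real \<open>x\<close>; \<open>powr\<close> is not meant for a negative base.
\<close>
definition rat_pow :: "nat \<Rightarrow> nat \<Rightarrow> real \<Rightarrow> real" where
  "rat_pow a b x = root b (x ^ a)"

text \<open>
  Nonnegative base with the convention \<open>0\<^sup>0 = 1\<close>, whereas \<open>0 powr 0 = 0\<close>.  The difference shows
  only when all \<open>n\<close> coordinates are considered, at boundary points.
\<close>
definition nn_pow :: "real \<Rightarrow> real \<Rightarrow> real" where
  "nn_pow a e = (if e = 0 then 1 else a powr e)"

text \<open>
  Points of \<open>n\<close>-space are extensional functions on \<open>{1..n}\<close>, and Lebesgue measure there is the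
  product of \<open>n\<close> copies of \<open>lborel\<close>.  Throughout, \<open>a\<close> and \<open>b\<close> are numerator and denominator of
  the exponent \<open>p\<close>.
\<close>
definition p_ball :: "nat \<Rightarrow> nat \<Rightarrow> real \<Rightarrow> nat \<Rightarrow> (nat \<Rightarrow> real) set" where
  "p_ball a b R n = {x \<in> {1..n} \<rightarrow>\<^sub>E UNIV.
     (\<Sum>i\<in>{1..n}. rat_pow a b (x i)) \<le> real n * R powr (real a / real b)}"

definition unif_p_ball :: "nat \<Rightarrow> nat \<Rightarrow> real \<Rightarrow> nat \<Rightarrow> (nat \<Rightarrow> real) measure" where
  "unif_p_ball a b R n = uniform_measure (Pi\<^sub>M {1..n} (\<lambda>_. lborel)) (p_ball a b R n)"

definition coord_density :: "nat \<Rightarrow> nat \<Rightarrow> real \<Rightarrow> nat \<Rightarrow> real \<Rightarrow> real" where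
  "coord_density a b R n t =
     (let p = real a / real b in
      if rat_pow a b t \<le> real n * R powr p
      then p * Gamma (1 + real n / p)
             / (2 * R * real n powr (1 / p) * Gamma (1 / p) * Gamma (1 + (real n - 1) / p))
           * nn_pow (1 - rat_pow a b t / (real n * R powr p)) ((real n - 1) / p)
      else 0)"

definition limit_density :: "nat \<Rightarrow> nat \<Rightarrow> real \<Rightarrow> real \<Rightarrow> real" where
  "limit_density a b R t =
     (let p = real a / real b in
      1 / (2 * R * Gamma (1 / p) * p powr (1 / p - 1)) * exp (- rat_pow a b t / (p * R powr p)))"

text \<open>The arguments of a \<open>k\<close>-variable density are \<open>x 1, \<dots>, x k\<close>.\<close>

definition joint_density :: "nat \<Rightarrow> nat \<Rightarrow> real \<Rightarrow> nat \<Rightarrow> nat \<Rightarrow> (nat \<Rightarrow> real) \<Rightarrow> real" where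
  "joint_density a b R n k x =
     (let p = real a / real b; s = (\<Sum>j\<in>{1..k}. rat_pow a b (x j)) in
      if s \<le> real n * R powr p
      then p ^ k * Gamma (1 + real n / p)
             / (2 ^ k * R ^ k * real n powr (real k / p) * Gamma (1 / p) ^ k
                * Gamma (1 + (real n - real k) / p))
           * nn_pow (1 - s / (real n * R powr p)) ((real n - real k) / p)
      else 0)"

definition limit_joint_density :: "nat \<Rightarrow> nat \<Rightarrow> real \<Rightarrow> nat \<Rightarrow> (nat \<Rightarrow> real) \<Rightarrow> real" where
  "limit_joint_density a b R k x =
     (let p = real a / real b; s = (\<Sum>j\<in>{1..k}. rat_pow a b (x j)) in
      1 / (2 ^ k * R ^ k * Gamma (1 / p) ^ k * p powr (real k / p - real k))
        * exp (- s / (p * R powr p)))"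

definition limit_law :: "nat \<Rightarrow> nat \<Rightarrow> real \<Rightarrow> nat \<Rightarrow> (nat \<Rightarrow> real) measure" where
  "limit_law a b R k =
     density (Pi\<^sub>M {1..k} (\<lambda>_. lborel)) (\<lambda>x. ennreal (limit_joint_density a b R k x))"

end

theory Submission
  imports Defs "HOL-Real_Asymp.Real_Asymp"
begin

text \<open>
  Since the \<open>p\<close>-ball is defined by a sum over coordinates, the density of \<open>k\<close> coordinates at \<open>y\<close> is the
  volume of the \<open>(n - k)\<close>-dimensional \<open>p\<close>-ball of level \<open>n R\<^sup>p - (y\<^sub>1\<^sup>p + \<dots> + y\<^sub>k\<^sup>p)\<close> divided by the volume
  of the \<open>n\<close>-dimensional one.  The volumes \<open>(2 \<Gamma>(1 + 1/p))\<^sup>m s\<^bsup>m/p\<^esup> / \<Gamma>(1 + m/p)\<close> come from an induction on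
  \<open>m\<close>: the image of Lebesgue measure under \<open>t \<mapsto> \<bar>t\<bar>\<^sup>p\<close> has density \<open>(2/p) w\<^bsup>1/p - 1\<^esup>\<close>, which turns the
  inductive step into a Beta integral.  For the limit, log-convexity of \<open>\<Gamma>\<close> gives
  \<open>\<Gamma>(x + c) \<sim> \<Gamma>(x) x\<^sup>c\<close>.
\<close>

section \<open>The Gamma recursion and powers of absolute values\<close>

lemma Gamma_plus1_real_pos:
  fixes x :: real
  assumes "x > 0"
  shows "Gamma (x + 1) = x * Gamma x"
  using assms by (intro Gamma_plus1) (auto elim!: nonpos_Ints_cases)

lemma Gamma_real_nonzero [simp]:
  fixes x :: real
  assumes "x > 0"
  shows "Gamma x \<noteq> 0"
  using Gamma_real_pos[OF assms] by simp

text \<open>Evenness of \<open>a\<close> makes \<open>x ^ a\<close> nonnegative, so the root is an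
  ordinary real power of |x|. The volume computation can therefore work with an arbitrary real
  exponent \<open>p > 0\<close>.\<close>

lemma rat_pow_eq_powr:
  assumes "b > 0" "a > 0" "even a"
  shows "rat_pow a b x = \<bar>x\<bar> powr (real a / real b)"
proof -
  have "x ^ a = \<bar>x\<bar> powr real a"
    using assms by (simp add: powr_realpow' power_even_abs)
  then show ?thesis
    using assms by (simp add: rat_pow_def root_powr_inverse powr_powr)
qed

lemma abs_powr_le_iff:
  fixes p t w :: real
  assumes "p > 0" "w \<ge> 0"
  shows "\<bar>t\<bar> powr p \<le> w \<longleftrightarrow> \<bar>t\<bar> \<le> w powr (1/p)"
proof
  assume "\<bar>t\<bar> powr p \<le> w"
  then have "(\<bar>t\<bar> powr p) powr (1/p) \<le> w powr (1/p)"
    using assms by (intro powr_mono2) auto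
  then show "\<bar>t\<bar> \<le> w powr (1/p)" using assms by (simp add: powr_powr)
next
  assume "\<bar>t\<bar> \<le> w powr (1/p)"
  then have "\<bar>t\<bar> powr p \<le> (w powr (1/p)) powr p"
    using assms by (intro powr_mono2) auto
  then show "\<bar>t\<bar> powr p \<le> w" using assms by (simp add: powr_powr)
qed

subsection \<open>Volume of the p-ball\<close>

text \<open>Both measures are compared on the half-lines \<open>{..w}\<close>, an
  intersection-stable generator of the Borel sets. For \<open>w \<ge> 0\<close> the sublevel set of
  |t|^p is an interval of length 2 w^(1/p), and the density is the derivative of this
  length.\<close>

lemma distr_abs_powr:
  fixes p :: real
  assumes p: "p > 0"
  shows "distr lborel borel (\<lambda>t. \<bar>t\<bar> powr p) =
    density lborel (\<lambda>w. indicator {0..} w * ennreal (2/p * w powr (1/p - 1)))" (is "?D = ?E")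
proof (rule measure_eqI_generator_eq[where E="range atMost" and \<Omega>=UNIV and A="\<lambda>i. {..real i}"])
  have D: "emeasure ?D {..w} = (if w < 0 then 0 else ennreal (2 * w powr (1/p)))" for w
  proof -
    have "emeasure ?D {..w} = emeasure lborel {t. \<bar>t\<bar> powr p \<le> w}"
      by (subst emeasure_distr) (auto intro!: arg_cong[where f="emeasure lborel"])
    also have "\<dots> = (if w < 0 then 0 else ennreal (2 * w powr (1/p)))"
    proof (cases "w < 0")
      case True
      then have "{t. \<bar>t\<bar> powr p \<le> w} = {}" by (auto simp: not_le intro: less_le_trans)
      then show ?thesis using True by simp
    next
      case False
      then have "{t. \<bar>t\<bar> powr p \<le> w} = {- (w powr (1/p))..w powr (1/p)}"
        using p by (auto simp: abs_powr_le_iff abs_le_iff)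
      then show ?thesis using False by simp
    qed
    finally show ?thesis .
  qed
  have E: "emeasure ?E {..w} = (if w < 0 then 0 else ennreal (2 * w powr (1/p)))" for w
  proof -
    have "emeasure ?E {..w} = (\<integral>\<^sup>+u. ennreal (2/p * u powr (1/p - 1)) * indicator {0..w} u \<partial>lborel)"
      by (subst emeasure_density) (auto intro!: nn_integral_cong split: split_indicator)
    also have "\<dots> = (if w < 0 then 0 else ennreal (2 * w powr (1/p)))"
    proof (cases "w < 0")
      case False
      \<comment> \<open>The exponent 1/p - 1 exceeds -1, so a singularity at 0 is
        integrable.\<close>
      then have "((\<lambda>u. 2/p * u powr (1/p - 1)) has_integral 2/p * (w powr (1/p) / (1/p))) {0..w}"
        using has_integral_powr_from_0[of "1/p - 1" w] p by (intro has_integral_mult_right) auto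
      from nn_integral_has_integral_lebesgue'[OF _ this] False p show ?thesis by simp
    qed auto
    finally show ?thesis .
  qed
  show "emeasure ?D X = emeasure ?E X" if "X \<in> range atMost" for X
    using that D E by auto
  show "emeasure ?D {..real i} \<noteq> \<infinity>" for i :: nat by (simp add: D)
  show "Int_stable (range (atMost :: real \<Rightarrow> _))"
    by (auto simp: Int_stable_def)
  show "(\<Union>i. {..real i}) = UNIV" by (auto intro: real_arch_simple)
  show "sets ?D = sigma_sets UNIV (range atMost)" "sets ?E = sigma_sets UNIV (range atMost)"
    by (simp_all add: borel_eq_atMost)
qed auto

lemma nn_integral_abs_powr:
  fixes p :: real and f :: "real \<Rightarrow> ennreal"
  assumes p: "p > 0" and [measurable]: "f \<in> borel_measurable borel"
  shows "(\<integral>\<^sup>+t. f (\<bar>t\<bar> powr p) \<partial>lborel) =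
    (\<integral>\<^sup>+w. indicator {0..} w * ennreal (2/p * w powr (1/p - 1)) * f w \<partial>lborel)"
proof -
  have "(\<integral>\<^sup>+t. f (\<bar>t\<bar> powr p) \<partial>lborel) = (\<integral>\<^sup>+w. f w \<partial>distr lborel borel (\<lambda>t. \<bar>t\<bar> powr p))"
    by (subst nn_integral_distr) auto
  then show ?thesis
    by (simp add: distr_abs_powr[OF p] nn_integral_density)
qed

text \<open>
  The parameter \<open>s\<close> is the level, i.e. the \<open>p\<close>-th power of the radius.
\<close>
definition p_ball_volume :: "real \<Rightarrow> nat \<Rightarrow> real \<Rightarrow> real" where
  "p_ball_volume p m s =
     (if s < 0 then 0
      else (2 * Gamma (1 + 1/p)) ^ m / Gamma (1 + real m / p) * nn_pow s (real m / p))"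

lemma nn_pow_nonneg: "0 \<le> nn_pow x e"
  by (simp add: nn_pow_def)

lemma borel_measurable_nn_pow [measurable]:
  "f \<in> borel_measurable M \<Longrightarrow> (\<lambda>x. nn_pow (f x) e) \<in> borel_measurable M"
  unfolding nn_pow_def by (cases "e = 0") auto

lemma borel_measurable_p_ball_volume [measurable]:
  assumes [measurable]: "f \<in> borel_measurable M"
  shows "(\<lambda>x. p_ball_volume p m (f x)) \<in> borel_measurable M"
  unfolding p_ball_volume_def by measurable

text \<open>The substitution w = s u reduces this to Euler's Beta integral on [0, 1] and pulls out s
  * s^(a-1) * s^e.\<close>

lemma nn_integral_Beta_scaled:
  fixes a e s :: real
  assumes a: "a > 0" and e: "e \<ge> 0" and s: "s > 0"
  shows "(\<integral>\<^sup>+w. ennreal (w powr (a - 1) * nn_pow (s - w) e) * indicator {0..s} w \<partial>lborel)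
    = ennreal (Beta a (1 + e) * s powr (a + e))"
proof -
  have "(\<integral>\<^sup>+w. ennreal (w powr (a - 1) * nn_pow (s - w) e) * indicator {0..s} w \<partial>lborel)
      = ennreal s * (\<integral>\<^sup>+u. ennreal ((s * u) powr (a - 1) * nn_pow (s - s * u) e) *
          indicator {0..s} (s * u) \<partial>lborel)"
    using s by (subst nn_integral_real_affine[where c=s and t=0]) auto
  also have "(\<integral>\<^sup>+u. ennreal ((s * u) powr (a - 1) * nn_pow (s - s * u) e) *
          indicator {0..s} (s * u) \<partial>lborel)
      = (\<integral>\<^sup>+u. ennreal (s powr (a - 1 + e) * (u powr (a - 1) * (1 - u) powr ((1 + e) - 1))) *
          indicator {0..1} u \<partial>lborel)"
  proof (rule nn_integral_cong_AE)
    show "AE u in lborel. ennreal ((s * u) powr (a - 1) * nn_pow (s - s * u) e) * indicator {0..s} (s * u)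
      = ennreal (s powr (a - 1 + e) * (u powr (a - 1) * (1 - u) powr ((1 + e) - 1))) * indicator {0..1} u"
      \<comment> \<open>The point u = 1 is discarded because the integrands differ there when
        \<open>e = 0\<close>: \<open>nn_pow 0 0\<close> is 1, but \<open>0 powr 0\<close> is
        0.\<close>
      using AE_lborel_singleton[of "1::real"]
    proof eventually_elim
      case (elim u)
      have "nn_pow (s - s * u) e = s powr e * (1 - u) powr e" if "0 \<le> u" "u < 1"
      proof (cases "e = 0")
        case True
        then show ?thesis using s that by (simp add: nn_pow_def)
      next
        case False
        then show ?thesis
          using s that powr_mult[of s "1 - u" e] by (simp add: nn_pow_def right_diff_distrib)
      qed
      then show ?case using elim s
        by (auto simp: powr_mult powr_add mult_ac mult_le_cancel_left1 zero_le_mult_iff split: split_indicator)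
    qed
  qed
  also have "\<dots> = ennreal (s powr (a - 1 + e) * Beta a (1 + e))"
    using a e by (intro nn_integral_has_integral_lebesgue' has_integral_mult_right has_integral_Beta_real) auto
  also have "ennreal s * \<dots> = ennreal (Beta a (1 + e) * s powr (a + e))"
  proof -
    have "s * s powr (a - 1 + e) = s powr (a + e)"
      using s powr_add[of s 1 "a - 1 + e"] by simp
    then have "s * (s powr (a - 1 + e) * Beta a (1 + e)) = Beta a (1 + e) * s powr (a + e)"
      by (simp add: mult_ac)
    then show ?thesis using s by (simp only: ennreal_mult'[symmetric] less_imp_le)
  qed
  finally show ?thesis .
qed

text \<open>This is the inductive step of the volume formula: fixing one coordinate \<open>t\<close>
  lowers the level by |t|^p. With w = |t|^p the slice volumes integrate to a Beta integral with
  parameters 1/p and 1 + m/p.\<close>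

lemma nn_integral_p_ball_volume:
  fixes p s :: real
  assumes p: "p > 0"
  shows "(\<integral>\<^sup>+t. ennreal (p_ball_volume p m (s - \<bar>t\<bar> powr p)) \<partial>lborel) = ennreal (p_ball_volume p (Suc m) s)"
proof -
  define e where "e = real m / p"
  define c where "c = (2 * Gamma (1 + 1/p)) ^ m / Gamma (1 + e)"
  have e: "e \<ge> 0" using p by (simp add: e_def)
  have c: "c \<ge> 0"
    using p e unfolding c_def
    by (intro divide_nonneg_nonneg zero_le_power mult_nonneg_nonneg less_imp_le[OF Gamma_real_pos]
      add_pos_nonneg) auto
  have volume: "p_ball_volume p m u = (if u < 0 then 0 else c * nn_pow u e)" for u
    by (simp add: p_ball_volume_def c_def e_def)
  have "(\<integral>\<^sup>+t. ennreal (p_ball_volume p m (s - \<bar>t\<bar> powr p)) \<partial>lborel)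
    = (\<integral>\<^sup>+w. indicator {0..} w * ennreal (2/p * w powr (1/p - 1)) * ennreal (p_ball_volume p m (s - w)) \<partial>lborel)"
    by (rule nn_integral_abs_powr[OF p, where f="\<lambda>w. ennreal (p_ball_volume p m (s - w))"]) measurable
  also have "\<dots> = (\<integral>\<^sup>+w. ennreal (2/p * c) * (ennreal (w powr (1/p - 1) * nn_pow (s - w) e) * indicator {0..s} w) \<partial>lborel)"
    using p c by (intro nn_integral_cong)
      (auto simp: volume nn_pow_nonneg ennreal_mult'[symmetric] mult_ac split: split_indicator)
  also have "\<dots> = ennreal (2/p * c) * (\<integral>\<^sup>+w. ennreal (w powr (1/p - 1) * nn_pow (s - w) e) * indicator {0..s} w \<partial>lborel)"
    by (intro nn_integral_cmult) measurable
  also have "\<dots> = ennreal (p_ball_volume p (Suc m) s)"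
  proof (cases "s > 0")
    case True
    have ee: "1 / p + e = real (Suc m) / p" by (simp add: e_def add_divide_distrib)
    have "Gamma (1 + e) > 0" using e by (intro Gamma_real_pos) auto
    moreover have "Gamma (1 + 1/p) = 1/p * Gamma (1/p)"
      using p Gamma_plus1_real_pos[of "1/p"] by (simp add: add.commute)
    \<comment> \<open>\<open>Gamma (1 + e)\<close> cancels between \<open>c\<close> and the Beta
      function, and 2/p times \<open>Gamma (1/p)\<close> supplies the additional factor
      \<open>2 * Gamma (1 + 1/p)\<close>.\<close>
    ultimately have "2/p * c * Beta (1/p) (1 + e) = (2 * Gamma (1 + 1/p)) ^ Suc m / Gamma (1 + real (Suc m) / p)"
      unfolding Beta_def c_def ee[symmetric] by (simp add: add_ac)
    moreover have "p_ball_volume p (Suc m) s =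
        (2 * Gamma (1 + 1/p)) ^ Suc m / Gamma (1 + real (Suc m) / p) * s powr (real (Suc m) / p)"
      using True p by (simp add: p_ball_volume_def nn_pow_def)
    ultimately have "2/p * c * (Beta (1/p) (1 + e) * s powr (1/p + e)) = p_ball_volume p (Suc m) s"
      by (simp only: ee flip: mult.assoc)
    moreover have "0 \<le> 2/p * c" using p c by simp
    ultimately show ?thesis
      using p True e by (simp only: nn_integral_Beta_scaled zero_less_divide_1_iff ennreal_mult'[symmetric])
  next
    case False
    \<comment> \<open>For \<open>s \<le> 0\<close> the interval \<open>{0..s}\<close> contains at
      most the point 0, where \<open>0 powr (1/p - 1)\<close> is 0, so the integrand vanishes
      everywhere.\<close>
    have "(\<integral>\<^sup>+w. ennreal (w powr (1/p - 1) * nn_pow (s - w) e) * indicator {0..s} w \<partial>lborel) = 0"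
    proof (intro nn_integral_zero' AE_I2)
      fix w :: real
      show "ennreal (w powr (1 / p - 1) * nn_pow (s - w) e) * indicator {0..s} w = 0"
        using False by (cases "w = 0") (auto split: split_indicator)
    qed
    then show ?thesis using False p by (simp add: p_ball_volume_def nn_pow_def)
  qed
  finally show ?thesis .
qed

text \<open>The index set is arbitrary because the formula is applied both to all coordinates and to
  those left after some are fixed. The level varies in the induction, since the slice at
  \<open>t\<close> has level s - |t|^p, possibly negative.\<close>

lemma emeasure_p_ball_volume:
  fixes p s :: real
  assumes p: "p > 0" and "finite J"
  shows "emeasure (Pi\<^sub>M J (\<lambda>_. lborel)) {z \<in> space (Pi\<^sub>M J (\<lambda>_. lborel)). (\<Sum>j\<in>J. \<bar>z j\<bar> powr p) \<le> s}
    = ennreal (p_ball_volume p (card J) s)"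
  using \<open>finite J\<close>
proof (induction J arbitrary: s)
  case empty
  interpret product_sigma_finite "\<lambda>_. lborel :: real measure" ..
  show ?case
    \<comment> \<open>The empty product is one point of mass 1 with coordinate sum 0. At
      \<open>s = 0\<close> the formula agrees because \<open>nn_pow 0 0\<close> is 1.\<close>
    by (cases "0 \<le> s") (auto simp: p_ball_volume_def nn_pow_def space_PiM PiM_empty emeasure_count_space)
next
  case (insert j J)
  interpret product_sigma_finite "\<lambda>_. lborel :: real measure" ..
  let ?P = "\<lambda>J. Pi\<^sub>M J (\<lambda>_. lborel :: real measure)"
  let ?B = "\<lambda>J s. {z \<in> space (?P J). (\<Sum>j\<in>J. \<bar>z j\<bar> powr p) \<le> s}"
  have [measurable]: "?B (insert j J) s \<in> sets (?P (insert j J))" by measurable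
  have "emeasure (?P (insert j J)) (?B (insert j J) s) = (\<integral>\<^sup>+z. indicator (?B (insert j J) s) z \<partial>?P (insert j J))"
    by simp
  also have "\<dots> = (\<integral>\<^sup>+t. (\<integral>\<^sup>+z. indicator (?B (insert j J) s) (z(j := t)) \<partial>?P J) \<partial>lborel)"
    using insert by (intro product_nn_integral_insert_rev) auto
  also have "\<dots> = (\<integral>\<^sup>+t. (\<integral>\<^sup>+z. indicator (?B J (s - \<bar>t\<bar> powr p)) z \<partial>?P J) \<partial>lborel)"
  proof (intro nn_integral_cong)
    fix t :: real and z assume z: "z \<in> space (?P J)"
    have "(\<Sum>i\<in>J. \<bar>(z(j := t)) i\<bar> powr p) = (\<Sum>i\<in>J. \<bar>z i\<bar> powr p)"
      using insert by (intro sum.cong) auto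
    moreover have "z(j := t) \<in> space (?P (insert j J))"
      using z by (auto simp: space_PiM PiE_def extensional_def)
    ultimately show "indicator (?B (insert j J) s) (z(j := t)) = (indicator (?B J (s - \<bar>t\<bar> powr p)) z :: ennreal)"
      using insert z by (auto simp del: fun_upd_apply simp add: fun_upd_same split: split_indicator)
  qed
  also have "\<dots> = (\<integral>\<^sup>+t. emeasure (?P J) (?B J (s - \<bar>t\<bar> powr p)) \<partial>lborel)"
    by (intro nn_integral_cong nn_integral_indicator) measurable
  also have "\<dots> = ennreal (p_ball_volume p (card (insert j J)) s)"
    using insert by (simp add: insert.IH nn_integral_p_ball_volume[OF p])
  finally show ?case .
qed

subsection \<open>Marginals of the uniform distribution\<close>

text \<open>
  \<open>m\<close> identifies \<open>P\<close> with a product whose first factor is the range of \<open>T\<close>; the density of \<open>T\<close> is then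
  the measure of the slices of \<open>A\<close>.
\<close>
lemma distributed_uniform_marginal:
  assumes "sigma_finite_measure L"
    and P: "P = distr (N \<Otimes>\<^sub>M L) P m" and m[measurable]: "m \<in> measurable (N \<Otimes>\<^sub>M L) P"
    and T[measurable]: "T \<in> measurable P N"
    and Tm: "\<And>y z. y \<in> space N \<Longrightarrow> z \<in> space L \<Longrightarrow> T (m (y, z)) = y"
    and A[measurable]: "A \<in> sets P" and A0: "emeasure P A \<noteq> 0" "emeasure P A \<noteq> \<infinity>"
    and g[measurable]: "g \<in> borel_measurable N"
    and gA: "\<And>y. y \<in> space N \<Longrightarrow> emeasure L {z \<in> space L. m (y, z) \<in> A} = g y * emeasure P A"
  shows "distributed (uniform_measure P A) N T g"
proof -
  interpret L: sigma_finite_measure L by fact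
  have "distr (uniform_measure P A) N T = density N g"
  proof (rule measure_eqI)
    fix B assume "B \<in> sets (distr (uniform_measure P A) N T)"
    then have B[measurable]: "B \<in> sets N" by simp
    let ?TB = "T -` B \<inter> space P"
    let ?X = "m -` (A \<inter> ?TB) \<inter> space (N \<Otimes>\<^sub>M L)"
    have X: "?X \<in> sets (N \<Otimes>\<^sub>M L)" by measurable
    have "emeasure P (A \<inter> ?TB) = emeasure (N \<Otimes>\<^sub>M L) ?X"
      by (subst P) (rule emeasure_distr, measurable)
    also have "\<dots> = (\<integral>\<^sup>+y. emeasure L (Pair y -` ?X) \<partial>N)"
      by (rule L.emeasure_pair_measure_alt[OF X])
    also have "\<dots> = (\<integral>\<^sup>+y. (g y * indicator B y) * emeasure P A \<partial>N)"
    proof (intro nn_integral_cong)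
      fix y assume y: "y \<in> space N"
      have "m (y, z) \<in> space P" if "z \<in> space L" for z
        using measurable_space[OF m] y that by (auto simp: space_pair_measure)
      \<comment> \<open>Since \<open>T\<close> recovers \<open>y\<close> from
        \<open>m (y, z)\<close>, membership in \<open>B\<close> depends on \<open>y\<close> alone:
        the slice is a full slice of \<open>A\<close> or empty.\<close>
      then have "Pair y -` ?X = (if y \<in> B then {z \<in> space L. m (y, z) \<in> A} else {})"
        using y by (auto simp: space_pair_measure Tm)
      then show "emeasure L (Pair y -` ?X) = g y * indicator B y * emeasure P A"
        using gA[OF y] by auto
    qed
    also have "\<dots> = emeasure (density N g) B * emeasure P A"
      by (subst nn_integral_multc) (auto simp: emeasure_density)
    finally have "emeasure P (A \<inter> ?TB) / emeasure P A = emeasure (density N g) B"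
      using A0 by (simp add: ennreal_mult_divide_eq)
    then show "emeasure (distr (uniform_measure P A) N T) B = emeasure (density N g) B"
      by (subst emeasure_distr) auto
  qed simp
  then show ?thesis by (auto simp: distributed_def)
qed

section \<open>Splitting a product measure along selected coordinates\<close>

text \<open>The map \<open>h\<close> places a point indexed by \<open>K\<close> on the coordinates
  \<open>i\<close>
  K\<open>and fills the others from\<close>z\<open>. The preimage of a box under\<close>h\<open>is
  again a box, so uniqueness of the product measure reduces the claim to splitting a finite product
  over\<close>i \<open>K\<close> and its complement.\<close>

lemma PiM_reindex_split:
  fixes M :: "'c measure" and i :: "'a \<Rightarrow> 'b"
  assumes M: "sigma_finite_measure M"
    and fin: "finite I" "finite K" and i: "inj_on i K" "i ` K \<subseteq> I"
  defines "h \<equiv> \<lambda>(y, z). \<lambda>l\<in>I. if l \<in> i ` K then y (inv_into K i l) else z l"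
  shows "h \<in> measurable (Pi\<^sub>M K (\<lambda>_. M) \<Otimes>\<^sub>M Pi\<^sub>M (I - i ` K) (\<lambda>_. M)) (Pi\<^sub>M I (\<lambda>_. M))" (is ?measurable)
    and "Pi\<^sub>M I (\<lambda>_. M) =
      distr (Pi\<^sub>M K (\<lambda>_. M) \<Otimes>\<^sub>M Pi\<^sub>M (I - i ` K) (\<lambda>_. M)) (Pi\<^sub>M I (\<lambda>_. M)) h" (is ?distr)
proof -
  interpret M: product_sigma_finite "\<lambda>_. M"
    using M by (simp add: product_sigma_finite_def)
  let ?J = "I - i ` K"
  let ?N = "Pi\<^sub>M K (\<lambda>_. M)" and ?L = "Pi\<^sub>M ?J (\<lambda>_. M)" and ?P = "Pi\<^sub>M I (\<lambda>_. M)"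
  interpret L: finite_product_sigma_finite "\<lambda>_. M" ?J
    using fin by unfold_locales auto
  show h[measurable]: ?measurable
    unfolding h_def case_prod_beta
  proof (rule measurable_restrict)
    fix l assume l: "l \<in> I"
    show "(\<lambda>x. if l \<in> i ` K then fst x (inv_into K i l) else snd x l) \<in> measurable (?N \<Otimes>\<^sub>M ?L) M"
    proof (cases "l \<in> i ` K")
      case True
      then have [measurable]: "(\<lambda>y. y (inv_into K i l)) \<in> measurable ?N M"
        by (intro measurable_component_singleton inv_into_into)
      show ?thesis using True by simp
    next
      case False
      then have [measurable]: "(\<lambda>z. z l) \<in> measurable ?L M"
        using l by (intro measurable_component_singleton) auto
      show ?thesis using False by simp
    qed
  qed
  have "distr (?N \<Otimes>\<^sub>M ?L) ?P h = ?P"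
  proof (rule M.PiM_eqI)
    fix A :: "'b \<Rightarrow> 'c set" assume A: "\<And>l. l \<in> I \<Longrightarrow> A l \<in> sets M"
    have Ai: "A (i j) \<in> sets M" if "j \<in> K" for j
      using A i that by auto
    have "h -` Pi\<^sub>E I A \<inter> space (?N \<Otimes>\<^sub>M ?L) = (\<Pi>\<^sub>E j\<in>K. A (i j)) \<times> Pi\<^sub>E ?J A" (is "?l = ?r")
    proof (intro equalityI subsetI)
      fix yz assume yz: "yz \<in> ?l"
      obtain y z where [simp]: "yz = (y, z)" by (cases yz)
      from yz have sp: "y \<in> extensional K" "z \<in> extensional ?J"
        by (auto simp: space_pair_measure space_PiM PiE_def)
      from yz have mem: "(if l \<in> i ` K then y (inv_into K i l) else z l) \<in> A l" if "l \<in> I" for l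
        using that by (auto simp: h_def PiE_iff split: if_splits)
      have "y j \<in> A (i j)" if "j \<in> K" for j
        using mem[of "i j"] that i by auto
      moreover have "z l \<in> A l" if "l \<in> ?J" for l
        using mem[of l] that by auto
      ultimately show "yz \<in> ?r" using sp by (auto simp: PiE_iff)
    next
      fix yz assume yz: "yz \<in> ?r"
      obtain y z where [simp]: "yz = (y, z)" by (cases yz)
      from yz have y: "y \<in> extensional K" "\<And>j. j \<in> K \<Longrightarrow> y j \<in> A (i j)"
        and z: "z \<in> extensional ?J" "\<And>l. l \<in> ?J \<Longrightarrow> z l \<in> A l"
        by (auto simp: PiE_iff)
      have "y j \<in> space M" if "j \<in> K" for j
        using y(2) sets.sets_into_space[OF Ai] that by blast
      moreover have "z l \<in> space M" if "l \<in> ?J" for l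
        using z(2) sets.sets_into_space[OF A] that by blast
      ultimately have "yz \<in> space (?N \<Otimes>\<^sub>M ?L)"
        using y(1) z(1) by (auto simp: space_pair_measure space_PiM PiE_iff)
      moreover have "h yz \<in> Pi\<^sub>E I A"
        using y z i by (auto simp: h_def PiE_iff)
      ultimately show "yz \<in> ?l" by simp
    qed
    then have "emeasure (distr (?N \<Otimes>\<^sub>M ?L) ?P h) (Pi\<^sub>E I A)
        = emeasure (?N \<Otimes>\<^sub>M ?L) ((\<Pi>\<^sub>E j\<in>K. A (i j)) \<times> Pi\<^sub>E ?J A)"
      using A fin by (subst emeasure_distr) (auto intro!: sets_PiM_I_finite)
    also have "\<dots> = (\<Prod>j\<in>K. emeasure M (A (i j))) * (\<Prod>l\<in>?J. emeasure M (A l))"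
    proof -
      have "emeasure ?L (Pi\<^sub>E ?J A) = (\<Prod>l\<in>?J. emeasure M (A l))"
        using A fin by (intro M.emeasure_PiM) auto
      moreover have "emeasure ?N (\<Pi>\<^sub>E j\<in>K. A (i j)) = (\<Prod>j\<in>K. emeasure M (A (i j)))"
        using Ai fin by (intro M.emeasure_PiM) auto
      ultimately show ?thesis
        using A Ai fin by (subst L.emeasure_pair_measure_Times) (auto intro!: sets_PiM_I_finite)
    qed
    also have "(\<Prod>j\<in>K. emeasure M (A (i j))) = (\<Prod>l\<in>i ` K. emeasure M (A l))"
      by (simp add: prod.reindex i)
    also have "(\<Prod>l\<in>i ` K. emeasure M (A l)) * (\<Prod>l\<in>?J. emeasure M (A l)) = (\<Prod>l\<in>I. emeasure M (A l))"
      using prod.subset_diff[OF i(2) fin(1), of "\<lambda>l. emeasure M (A l)"] by (simp add: mult.commute)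
    finally show "emeasure (distr (?N \<Otimes>\<^sub>M ?L) ?P h) (Pi\<^sub>E I A) = (\<Prod>l\<in>I. emeasure M (A l))" .
  qed (use fin in auto)
  then show ?distr by simp
qed

section \<open>The joint density as a quotient of volumes\<close>

text \<open>Two splittings account for the constants: (2 Gamma(1/p) / p)^n into its (n-k)-th and
  k-th powers, and s0^(n/p) into s0^((n-k)/p) times n^(k/p) R^k.\<close>

lemma joint_density_times_volume:
  fixes R :: real
  assumes R: "R > 0" and b: "b > 0" and a: "a > 0" "even a" and kn: "k \<le> n" "n > 0"
  defines "p \<equiv> real a / real b"
  defines "s0 \<equiv> real n * R powr p"
  shows "joint_density a b R n k y * p_ball_volume p n s0 =
    p_ball_volume p (n - k) (s0 - (\<Sum>j\<in>{1..k}. \<bar>y j\<bar> powr p))"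
proof -
  define s where "s = (\<Sum>j\<in>{1..k}. \<bar>y j\<bar> powr p)"
  define e where "e = (real n - real k) / p"
  define g where "g = Gamma (1 / p)"
  have p: "p > 0" using a b by (simp add: p_def)
  have s0: "s0 > 0" using kn R by (simp add: s0_def)
  have e: "e \<ge> 0" using kn p by (simp add: e_def)
  have "1 + real n / p > 0" "1 / p > 0" "1 + e > 0" using p e by (auto intro!: add_pos_pos add_pos_nonneg)
  then have pos: "Gamma (1 + real n / p) \<noteq> 0" "g \<noteq> 0" "Gamma (1 + e) \<noteq> 0"
    unfolding g_def by (metis Gamma_real_nonzero)+
  have s: "s = (\<Sum>j\<in>{1..k}. rat_pow a b (y j))"
    using a b by (simp add: s_def p_def rat_pow_eq_powr)
  show ?thesis
  proof (cases "s \<le> s0")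
    case False
    then show ?thesis
      unfolding joint_density_def Let_def p_def[symmetric] s[symmetric] s_def[symmetric] s0_def[symmetric]
      by (simp add: p_ball_volume_def)
  next
    case True
    have G1: "Gamma (1 + 1/p) = g / p"
      using p Gamma_plus1_real_pos[of "1/p"] by (simp add: add.commute g_def)
    have "(2 * g / p) ^ n = (2 * g / p) ^ (n - k) * (2 * g / p) ^ k"
      using kn by (simp flip: power_add)
    also have "(2 * g / p) ^ k = 2 ^ k * g ^ k / p ^ k"
      by (simp add: power_divide power_mult_distrib)
    finally have pow: "(2 * g / p) ^ n = (2 * g / p) ^ (n - k) * (2 ^ k * g ^ k / p ^ k)" .
    have "s0 powr (real n / p) = s0 powr (e + real k / p)"
      by (simp add: e_def diff_divide_distrib)
    also have "\<dots> = s0 powr e * s0 powr (real k / p)" by (simp add: powr_add)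
    also have "s0 powr (real k / p) = real n powr (real k / p) * R ^ k"
      using R p by (simp add: s0_def powr_mult powr_powr powr_realpow)
    finally have s0n: "s0 powr (real n / p) = s0 powr e * (real n powr (real k / p) * R ^ k)" .
    \<comment> \<open>For \<open>k = n\<close> the exponent is 0 and both \<open>nn_pow\<close>
      factors are 1, even on the boundary \<open>s = s0\<close>. Otherwise \<open>nn_pow\<close> is
      \<open>powr\<close>, which is multiplicative.\<close>
    have "nn_pow (1 - s / s0) e * s0 powr e = nn_pow (s0 - s) e"
    proof (cases "e = 0")
      case False
      have "s0 - s = (1 - s / s0) * s0" using s0 by (simp add: field_simps)
      moreover have "((1 - s / s0) * s0) powr e = (1 - s / s0) powr e * s0 powr e"
        by (rule powr_mult)
      ultimately show ?thesis using False by (simp add: nn_pow_def)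
    qed (use s0 in \<open>simp add: nn_pow_def\<close>)
    then have nn: "nn_pow (s0 - s) e = nn_pow (1 - s / s0) e * s0 powr e" ..
    have jd: "joint_density a b R n k y = p ^ k * Gamma (1 + real n / p)
        / (2 ^ k * R ^ k * real n powr (real k / p) * g ^ k * Gamma (1 + e)) * nn_pow (1 - s / s0) e"
      using True unfolding joint_density_def Let_def p_def[symmetric] s[symmetric] s0_def[symmetric]
      by (simp add: g_def e_def)
    have vol_n: "p_ball_volume p n s0 = (2 * g / p) ^ n / Gamma (1 + real n / p) * s0 powr (real n / p)"
      using s0 p kn by (simp add: p_ball_volume_def nn_pow_def G1)
    have vol_nk: "p_ball_volume p (n - k) (s0 - s) = (2 * g / p) ^ (n - k) / Gamma (1 + e) * nn_pow (s0 - s) e"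
      using True kn by (simp add: p_ball_volume_def G1 of_nat_diff e_def)
    show ?thesis
      unfolding s_def[symmetric] jd vol_n vol_nk pow s0n nn using p R kn pos by simp
  qed
qed

lemma borel_measurable_joint_density:
  assumes "b > 0" "a > 0" "even a"
  shows "joint_density a b R n k \<in> borel_measurable (Pi\<^sub>M {1..k} (\<lambda>_. lborel))"
proof -
  have [measurable]: "(\<lambda>x. \<Sum>j\<in>{1..k}. rat_pow a b (x j)) \<in> borel_measurable (Pi\<^sub>M {1..k} (\<lambda>_. lborel))"
    unfolding rat_pow_eq_powr[OF assms] by measurable
  show ?thesis
    unfolding joint_density_def[abs_def] Let_def by measurable
qed

text \<open>This applies \<open>distributed_uniform_marginal\<close> with the gluing map of
  \<open>PiM_reindex_split\<close>. The slice of the ball over \<open>y\<close> is a ball in the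
  remaining \<open>n - k\<close> coordinates, so its measure is a known volume.\<close>

lemma distributed_joint_density:
  fixes R :: real
  assumes R: "R > 0" and b: "b > 0" and a: "a > 0" "even a"
    and k: "1 \<le> k" and i: "inj_on i {1..k}" "i ` {1..k} \<subseteq> {1..n}"
  shows "distributed (unif_p_ball a b R n) (Pi\<^sub>M {1..k} (\<lambda>_. lborel))
    (\<lambda>x. \<lambda>j\<in>{1..k}. x (i j)) (\<lambda>x. ennreal (joint_density a b R n k x))"
proof -
  let ?K = "{1..k}" and ?I = "{1..n}"
  let ?J = "?I - i ` ?K"
  let ?PM = "\<lambda>I. Pi\<^sub>M I (\<lambda>_. lborel :: real measure)"
  let ?h = "\<lambda>(y, z). \<lambda>l\<in>?I. if l \<in> i ` ?K then y (inv_into ?K i l) else z l"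
  define p where "p = real a / real b"
  define s0 where "s0 = real n * R powr p"
  have p: "p > 0" using a b by (simp add: p_def)
  have card: "card (i ` ?K) = k" using i by (simp add: card_image)
  have card_J: "card ?J = n - k"
    using card_Diff_subset[OF _ i(2)] card by simp
  have kn: "k \<le> n" using card_mono[OF _ i(2)] card by simp
  then have n: "n > 0" using k by simp
  have s0: "s0 > 0" using n R by (simp add: s0_def)
  interpret product_sigma_finite "\<lambda>_. lborel :: real measure" ..
  interpret J: finite_product_sigma_finite "\<lambda>_. lborel :: real measure" ?J
    by unfold_locales auto
  note split = PiM_reindex_split[OF sigma_finite_lborel, of ?I ?K i, OF _ _ i]
  have ball: "p_ball a b R n = {x \<in> space (?PM ?I). (\<Sum>l\<in>?I. \<bar>x l\<bar> powr p) \<le> s0}"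
    using a b by (simp add: p_ball_def space_PiM rat_pow_eq_powr s0_def p_def)
  have vol: "emeasure (?PM ?I) (p_ball a b R n) = ennreal (p_ball_volume p n s0)"
    unfolding ball by (subst emeasure_p_ball_volume[OF p]) auto
  have vol_pos: "p_ball_volume p n s0 > 0"
  proof -
    have "Gamma (1 + 1/p) > 0" "Gamma (1 + real n / p) > 0"
      using p by (auto intro!: Gamma_real_pos add_pos_nonneg)
    then show ?thesis using s0 by (simp add: p_ball_volume_def nn_pow_def)
  qed
  show ?thesis
    unfolding unif_p_ball_def
  proof (rule distributed_uniform_marginal[where L="?PM ?J" and m="?h"])
    show "?h \<in> measurable (?PM ?K \<Otimes>\<^sub>M ?PM ?J) (?PM ?I)"
      by (rule split) auto
    show "?PM ?I = distr (?PM ?K \<Otimes>\<^sub>M ?PM ?J) (?PM ?I) ?h"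
      by (rule split) auto
    show "(\<lambda>x. \<lambda>j\<in>?K. x (i j)) \<in> measurable (?PM ?I) (?PM ?K)"
      by (intro measurable_restrict measurable_component_singleton) (use i in blast)
    show "p_ball a b R n \<in> sets (?PM ?I)" unfolding ball by measurable
    show "emeasure (?PM ?I) (p_ball a b R n) \<noteq> 0" using vol vol_pos by simp
    show "emeasure (?PM ?I) (p_ball a b R n) \<noteq> \<infinity>" using vol by simp
    show "(\<lambda>x. ennreal (joint_density a b R n k x)) \<in> borel_measurable (?PM ?K)"
      using borel_measurable_joint_density[of b a R n k] a b by measurable
    show "sigma_finite_measure (?PM ?J)" by (rule J.sigma_finite_measure_axioms)
    show "(\<lambda>j\<in>?K. ?h (y, z) (i j)) = y" if "y \<in> space (?PM ?K)" for y z
    proof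
      fix j show "(\<lambda>j\<in>?K. ?h (y, z) (i j)) j = y j"
        using that i by (auto simp: space_PiM PiE_def extensional_def image_subset_iff)
    qed
    fix y assume y: "y \<in> space (?PM ?K)"
    \<comment> \<open>The defining sum decouples into chosen and remaining coordinates; this makes
      every slice a ball again.\<close>
    have sum: "(\<Sum>l\<in>?I. \<bar>?h (y, z) l\<bar> powr p) = (\<Sum>j\<in>?K. \<bar>y j\<bar> powr p) + (\<Sum>l\<in>?J. \<bar>z l\<bar> powr p)" for z
    proof -
      have "(\<Sum>l\<in>?I. \<bar>?h (y, z) l\<bar> powr p) =
          (\<Sum>l\<in>?J. \<bar>?h (y, z) l\<bar> powr p) + (\<Sum>l\<in>i ` ?K. \<bar>?h (y, z) l\<bar> powr p)"
        by (rule sum.subset_diff[OF i(2)]) simp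
      also have "(\<Sum>l\<in>i ` ?K. \<bar>?h (y, z) l\<bar> powr p) = (\<Sum>j\<in>?K. \<bar>y j\<bar> powr p)"
        using i by (subst sum.reindex) (auto intro!: sum.cong simp: image_subset_iff)
      also have "(\<Sum>l\<in>?J. \<bar>?h (y, z) l\<bar> powr p) = (\<Sum>l\<in>?J. \<bar>z l\<bar> powr p)"
        by (intro sum.cong) auto
      finally show ?thesis by simp
    qed
    have "{z \<in> space (?PM ?J). ?h (y, z) \<in> p_ball a b R n} =
        {z \<in> space (?PM ?J). (\<Sum>l\<in>?J. \<bar>z l\<bar> powr p) \<le> s0 - (\<Sum>j\<in>?K. \<bar>y j\<bar> powr p)}"
    proof -
      have "?h (y, z) \<in> space (?PM ?I)" for z by (simp add: space_PiM)
      then have "?h (y, z) \<in> p_ball a b R n \<longleftrightarrow> (\<Sum>l\<in>?I. \<bar>?h (y, z) l\<bar> powr p) \<le> s0" for z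
        unfolding ball by blast
      then show ?thesis unfolding sum by (simp only: le_diff_eq add.commute)
    qed
    then have "emeasure (?PM ?J) {z \<in> space (?PM ?J). ?h (y, z) \<in> p_ball a b R n}
        = ennreal (p_ball_volume p (n - k) (s0 - (\<Sum>j\<in>?K. \<bar>y j\<bar> powr p)))"
      by (simp only: emeasure_p_ball_volume[OF p finite_Diff[OF finite_atLeastAtMost]] card_J)
    also have "\<dots> = ennreal (joint_density a b R n k y * p_ball_volume p n s0)"
      using joint_density_times_volume[OF R b a kn n, of y] by (simp add: p_def s0_def)
    also have "\<dots> = ennreal (joint_density a b R n k y) * emeasure (?PM ?I) (p_ball a b R n)"
      using vol_pos by (simp only: vol ennreal_mult'' less_imp_le)
    finally show "emeasure (?PM ?J) {z \<in> space (?PM ?J). ?h (y, z) \<in> p_ball a b R n}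
      = ennreal (joint_density a b R n k y) * emeasure (?PM ?I) (p_ball a b R n)" .
  qed
qed

section \<open>The case of a single coordinate\<close>

lemma joint_density_1: "joint_density a b R n 1 x = coord_density a b R n (x 1)"
  by (simp add: joint_density_def coord_density_def Let_def)

lemma limit_joint_density_1: "limit_joint_density a b R 1 x = limit_density a b R (x 1)"
  by (simp add: limit_joint_density_def limit_density_def Let_def)

lemma borel_measurable_coord_density:
  assumes "b > 0" "a > 0" "even a"
  shows "coord_density a b R n \<in> borel_measurable borel"
  unfolding coord_density_def[abs_def] Let_def rat_pow_eq_powr[OF assms] by measurable

text \<open>The joint law for one coordinate lives on functions on \<open>{1}\<close>. Evaluation at
  1 carries it to the real line and sends the one-fold product of \<open>lborel\<close> to
  \<open>lborel\<close>.\<close>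

lemma distributed_coord_density:
  fixes R :: real
  assumes R: "R > 0" and b: "b > 0" and a: "a > 0" "even a" and k: "k \<in> {1..n}"
  shows "distributed (unif_p_ball a b R n) lborel (\<lambda>x. x k) (\<lambda>t. ennreal (coord_density a b R n t))"
proof -
  interpret product_sigma_finite "\<lambda>_. lborel :: real measure" ..
  let ?N = "Pi\<^sub>M {1::nat} (\<lambda>_. lborel :: real measure)"
  let ?U = "unif_p_ball a b R n"
  have [measurable]: "coord_density a b R n \<in> borel_measurable borel"
    using b a by (rule borel_measurable_coord_density)
  have "{1..1::nat} = {1}" by auto
  then have D: "distributed ?U ?N (\<lambda>x. \<lambda>j\<in>{1}. x k) (\<lambda>x. ennreal (coord_density a b R n (x 1)))"
    using distributed_joint_density[OF R b a, of 1 "\<lambda>_. k" n] k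
    by (simp only: joint_density_1) (auto simp: inj_on_def)
  then have X: "(\<lambda>x. \<lambda>j\<in>{1::nat}. x k) \<in> measurable ?U ?N"
    and eq: "distr ?U ?N (\<lambda>x. \<lambda>j\<in>{1}. x k) = density ?N (\<lambda>x. ennreal (coord_density a b R n (x 1)))"
    by (auto simp: distributed_def)
  have "distr ?U lborel (\<lambda>x. x k) = distr (distr ?U ?N (\<lambda>x. \<lambda>j\<in>{1}. x k)) lborel (\<lambda>y. y 1)"
    using X by (subst distr_distr) (auto simp: o_def)
  also have "\<dots> = density (distr ?N lborel (\<lambda>y. y 1)) (\<lambda>t. ennreal (coord_density a b R n t))"
    unfolding eq by (rule density_distr[symmetric]) measurable
  also have "distr ?N lborel (\<lambda>y. y 1) = lborel"
    by (rule distr_singleton)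
  finally have "distr ?U lborel (\<lambda>x. x k) = density lborel (\<lambda>t. ennreal (coord_density a b R n t))" .
  moreover have "(\<lambda>x. x k) \<in> measurable ?U lborel"
    using k by (auto simp: unif_p_ball_def measurable_def space_PiM)
  ultimately show ?thesis by (simp add: distributed_def)
qed

subsection \<open>Limit of the densities\<close>

lemma Gamma_log_convex:
  fixes x y t :: real
  assumes "x > 0" "y > 0" "0 \<le> t" "t \<le> 1"
  shows "ln (Gamma ((1 - t) * x + t * y)) \<le> (1 - t) * ln (Gamma x) + t * ln (Gamma y)"
  using convex_onD[OF log_convex_Gamma_real, of t x y] assms by simp

text \<open>The logarithm of the ratio is squeezed to 0. The bound \<open>c \<le> 1\<close> makes
  \<open>x + c\<close> a convex combination of \<open>x\<close> and \<open>x + 1\<close>, where the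
  recursion controls Gamma.\<close>

lemma Gamma_shift_ratio_le_1:
  fixes c :: real
  assumes c: "0 < c" "c \<le> 1"
  shows "((\<lambda>x. Gamma (x + c) / (Gamma x * x powr c)) \<longlongrightarrow> 1) at_top"
proof -
  let ?D = "\<lambda>x. ln (Gamma (x + c)) - ln (Gamma x) - c * ln x"
  have ln_Gamma_plus1: "ln (Gamma (x + 1)) = ln x + ln (Gamma x)" if "x > 0" for x :: real
    using that by (simp add: Gamma_plus1_real_pos ln_mult)
  \<comment> \<open>Convexity between \<open>x\<close>, \<open>x + 1\<close> for the upper bound and \<open>x + c\<close>, \<open>x + c + 1\<close> for the lower one.\<close>
  have upper: "?D x \<le> 0" if x: "x > 0" for x
  proof -
    have "ln (Gamma ((1 - c) * x + c * (x + 1))) \<le> (1 - c) * ln (Gamma x) + c * ln (Gamma (x + 1))"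
      using c x by (intro Gamma_log_convex) auto
    moreover have "(1 - c) * x + c * (x + 1) = x + c" by (simp add: algebra_simps)
    ultimately show ?thesis
      using ln_Gamma_plus1[OF x] by (simp add: algebra_simps)
  qed
  have lower: "(1 - c) * (ln x - ln (x + c)) \<le> ?D x" if x: "x > 0" for x
  proof -
    have "ln (Gamma ((1 - c) * (x + c + 1) + c * (x + c))) \<le>
        (1 - c) * ln (Gamma (x + c + 1)) + c * ln (Gamma (x + c))"
      using Gamma_log_convex[of "x + c + 1" "x + c" c] c x by simp
    moreover have "(1 - c) * (x + c + 1) + c * (x + c) = x + 1" by (simp add: algebra_simps)
    ultimately show ?thesis
      using x c ln_Gamma_plus1[of "x + c"] ln_Gamma_plus1[of x] by (simp add: algebra_simps)
  qed
  have "(?D \<longlongrightarrow> 0) at_top"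
  proof (rule tendsto_sandwich)
    show "((\<lambda>x. (1 - c) * (ln x - ln (x + c))) \<longlongrightarrow> 0) at_top" by real_asymp
    show "\<forall>\<^sub>F x in at_top. (1 - c) * (ln x - ln (x + c)) \<le> ?D x"
      using eventually_gt_at_top[of 0] by eventually_elim (rule lower)
    show "\<forall>\<^sub>F x in at_top. ?D x \<le> 0"
      using eventually_gt_at_top[of 0] by eventually_elim (rule upper)
  qed simp
  from tendsto_exp[OF this] have "((\<lambda>x. exp (?D x)) \<longlongrightarrow> 1) at_top" by simp
  then show ?thesis
  proof (rule Lim_transform_eventually)
    show "\<forall>\<^sub>F x in at_top. exp (?D x) = Gamma (x + c) / (Gamma x * x powr c)"
      using eventually_gt_at_top[of 0]
    proof eventually_elim
      case (elim x)
      then have "Gamma (x + c) > 0" "Gamma x > 0" using c by (auto intro: Gamma_real_pos)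
      then show ?case using elim by (simp add: exp_diff powr_def)
    qed
  qed
qed

text \<open>A long shift is composed of \<open>k\<close> shifts by \<open>c\<close>, each covered by
  the previous lemma. It is used with \<open>c = 1/p\<close>, which is where
  \<open>p \<ge> 1\<close> enters.\<close>

lemma Gamma_shift_ratio:
  fixes c :: real
  assumes c: "0 < c" "c \<le> 1"
  shows "((\<lambda>x. Gamma (x + real k * c) / (Gamma x * x powr (real k * c))) \<longlongrightarrow> 1) at_top"
proof (induction k)
  case 0
  have "\<forall>\<^sub>F x :: real in at_top. 1 = Gamma x / (Gamma x * x powr 0)"
    using eventually_gt_at_top[of 0]
  proof eventually_elim
    case (elim x)
    then show ?case by simp
  qed
  then show ?case by (intro Lim_transform_eventually[OF tendsto_const]) simp
next
  case (Suc k)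
  define d where "d = real k * c"
  have d: "d \<ge> 0" using c by (simp add: d_def)
  have "filterlim (\<lambda>x :: real. x + d) at_top at_top" by real_asymp
  from filterlim_compose[OF Gamma_shift_ratio_le_1[OF c] this]
  have "((\<lambda>x. Gamma (x + d + c) / (Gamma (x + d) * (x + d) powr c)) \<longlongrightarrow> 1) at_top" .
  \<comment> \<open>This factor exchanges (x + d)^c for x^c in the denominator.\<close>
  moreover have "((\<lambda>x. ((x + d) / x) powr c) \<longlongrightarrow> 1) at_top" by real_asymp
  ultimately have "((\<lambda>x. Gamma (x + d + c) / (Gamma (x + d) * (x + d) powr c) *
      (Gamma (x + d) / (Gamma x * x powr d)) * ((x + d) / x) powr c) \<longlongrightarrow> 1 * 1 * 1) at_top"
    using Suc unfolding d_def[symmetric] by (intro tendsto_mult)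
  then have "((\<lambda>x. Gamma (x + (d + c)) / (Gamma x * x powr (d + c))) \<longlongrightarrow> 1 * 1 * 1) at_top"
  proof (rule Lim_transform_eventually)
    show "\<forall>\<^sub>F x in at_top. Gamma (x + d + c) / (Gamma (x + d) * (x + d) powr c) *
      (Gamma (x + d) / (Gamma x * x powr d)) * ((x + d) / x) powr c
       = Gamma (x + (d + c)) / (Gamma x * x powr (d + c))"
      using eventually_gt_at_top[of 0]
    proof eventually_elim
      case (elim x)
      then have "Gamma (x + d) > 0" "Gamma x > 0" using d by (auto intro: Gamma_real_pos)
      then show ?case using elim d
        by (simp add: powr_divide powr_add add_ac)
    qed
  qed
  then show ?case by (simp add: d_def algebra_simps)
qed

text \<open>With m = 1 + (n-k)/p and d = k/p, the Gamma quotient Gamma(m + d) / Gamma(m) behaves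
  like m^d. Against n^d this leaves p^(-d), and (1 - e/n)^((n-k)/p) tends to exp(-e/p).\<close>

lemma tendsto_joint_density:
  fixes R :: real
  assumes R: "R > 0" and p: "real a / real b \<ge> 1"
  shows "(\<lambda>n. joint_density a b R n k x) \<longlonglongrightarrow> limit_joint_density a b R k x"
proof -
  define p where "p = real a / real b"
  define s where "s = (\<Sum>j\<in>{1..k}. rat_pow a b (x j))"
  define d where "d = real k / p"
  define e where "e = s / R powr p"
  define C where "C = p ^ k / (2 ^ k * R ^ k * Gamma (1 / p) ^ k)"
  define m where "m n = 1 + (real n - real k) / p" for n
  have p1: "p \<ge> 1" using p by (simp add: p_def)
  then have p0: "p > 0" by simp
  have m_top: "filterlim m at_top at_top" unfolding m_def using p0 by real_asymp
  from filterlim_compose[OF Gamma_shift_ratio[of "1/p" k] m_top]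
  have "(\<lambda>n. Gamma (m n + d) / (Gamma (m n) * m n powr d)) \<longlonglongrightarrow> 1"
    using p1 by (simp add: d_def)
  moreover have "(\<lambda>n. (m n / n) powr d) \<longlonglongrightarrow> inverse p powr d"
    unfolding m_def using p0 by real_asymp
  moreover have "(\<lambda>n. (1 - e / n) powr ((real n - real k) / p)) \<longlonglongrightarrow> exp (- (e * inverse p))"
    using p0 by real_asymp
  ultimately have lim: "(\<lambda>n. C * (Gamma (m n + d) / (Gamma (m n) * m n powr d)) * (m n / n) powr d *
      (1 - e / n) powr ((real n - real k) / p)) \<longlonglongrightarrow> C * 1 * inverse p powr d * exp (- (e * inverse p))"
    by (intro tendsto_mult tendsto_const)
  have const: "C * 1 * inverse p powr d * exp (- (e * inverse p)) = limit_joint_density a b R k x"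
  proof -
    have "p powr (real k / p - real k) = p powr d / p ^ k"
      using p0 by (simp add: d_def powr_diff powr_realpow)
    then show ?thesis using p0 R
      unfolding limit_joint_density_def Let_def p_def[symmetric] s_def[symmetric]
      by (simp add: C_def inverse_eq_divide powr_divide e_def mult_ac)
  qed
  have "\<forall>\<^sub>F n in sequentially. C * (Gamma (m n + d) / (Gamma (m n) * m n powr d)) * (m n / n) powr d *
      (1 - e / n) powr ((real n - real k) / p) = joint_density a b R n k x"
  proof -
    \<comment> \<open>Once \<open>e < n\<close>, the point lies inside the support; once
      \<open>k < n\<close>, the exponent is positive and \<open>nn_pow\<close> is
      \<open>powr\<close>.\<close>
    have "\<forall>\<^sub>F n in sequentially. e < real n" by real_asymp
    then show ?thesis using eventually_gt_at_top[of k]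
    proof eventually_elim
      case (elim n)
      then have n: "real n > 0" "real n - real k > 0" by auto
      have "s \<le> real n * R powr p" using elim R by (simp add: e_def field_simps)
      moreover have "m n > 0" "m n + d = 1 + real n / p" using n p0
        by (auto simp: m_def d_def diff_divide_distrib divide_strict_right_mono intro!: add_pos_pos)
      moreover have "Gamma (m n) > 0" using \<open>m n > 0\<close> by (rule Gamma_real_pos)
      moreover have "(m n / n) powr d = m n powr d / n powr d"
        using \<open>m n > 0\<close> n by (simp add: powr_divide)
      moreover have "e / n = s / (real n * R powr p)" by (simp add: e_def)
      ultimately show ?case
        unfolding joint_density_def Let_def p_def[symmetric] s_def[symmetric] using n p0
        by (simp add: C_def nn_pow_def d_def[symmetric] m_def[symmetric] mult_ac)
    qed
  qed
  with lim show ?thesis unfolding const by (rule Lim_transform_eventually)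
qed

subsection \<open>The limit law\<close>

lemma limit_joint_density_eq_prod:
  fixes R :: real
  assumes "b > 0" "a > 0"
  shows "limit_joint_density a b R k x = (\<Prod>j\<in>{1..k}. limit_density a b R (x j))"
proof -
  define p where "p = real a / real b"
  define c where "c = p * R powr p"
  define C where "C = 2 * R * Gamma (1 / p) * p powr (1 / p - 1)"
  have p: "p > 0" using assms by (simp add: p_def)
  have "p powr (real k / p - real k) = (p powr (1 / p - 1)) ^ k"
    using p by (simp add: powr_power algebra_simps)
  then have "2 ^ k * R ^ k * Gamma (1 / p) ^ k * p powr (real k / p - real k) = C ^ k"
    by (simp add: C_def power_mult_distrib)
  moreover have "exp (- (\<Sum>j\<in>{1..k}. rat_pow a b (x j)) / c) = (\<Prod>j\<in>{1..k}. exp (- rat_pow a b (x j) / c))"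
    by (simp add: exp_sum[symmetric] sum_negf sum_divide_distrib)
  ultimately show ?thesis
    unfolding limit_joint_density_def limit_density_def Let_def p_def[symmetric] c_def[symmetric] C_def[symmetric]
    by (simp add: prod.distrib power_divide prod_dividef)
qed

text \<open>Pointwise convergence of densities does not by itself preserve total mass, so the mass
  is computed directly. The substitutions w = |t|^p and w = c u with c = p R^p lead to the Gamma
  integral at 1/p.\<close>

lemma nn_integral_limit_density:
  fixes R :: real
  assumes R: "R > 0" and b: "b > 0" and a: "a > 0" "even a"
  shows "(\<integral>\<^sup>+t. ennreal (limit_density a b R t) \<partial>lborel) = 1"
proof -
  define p where "p = real a / real b"
  define c where "c = p * R powr p"
  define C where "C = 2 * R * Gamma (1 / p) * p powr (1 / p - 1)"
  have p: "p > 0" using a b by (simp add: p_def)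
  have c: "c > 0" using p R by (simp add: c_def)
  have C: "C > 0" using p R by (simp add: C_def Gamma_real_pos)
  have "(\<integral>\<^sup>+t. ennreal (limit_density a b R t) \<partial>lborel)
    = (\<integral>\<^sup>+t. ennreal (1 / C * exp (- (\<bar>t\<bar> powr p) / c)) \<partial>lborel)"
    unfolding limit_density_def Let_def p_def[symmetric] c_def[symmetric] C_def[symmetric]
    using a b by (simp add: rat_pow_eq_powr p_def)
  also have "\<dots> = (\<integral>\<^sup>+w. indicator {0..} w * ennreal (2/p * w powr (1/p - 1)) * ennreal (1 / C * exp (- w / c)) \<partial>lborel)"
    by (rule nn_integral_abs_powr[OF p, where f="\<lambda>w. ennreal (1 / C * exp (- w / c))"]) measurable
  also have "\<dots> = ennreal c * (\<integral>\<^sup>+u. indicator {0..} (c * u) * ennreal (2/p * (c * u) powr (1/p - 1)) *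
      ennreal (1 / C * exp (- (c * u) / c)) \<partial>lborel)"
    using c by (subst nn_integral_real_affine[where c=c and t=0]) auto
  also have "\<dots> = ennreal c * (\<integral>\<^sup>+u. ennreal (2 / (p * C) * c powr (1/p - 1)) *
      ennreal (indicator {0..} u * u powr (1/p - 1) / exp u) \<partial>lborel)"
  proof (intro arg_cong[where f="(*) (ennreal c)"] nn_integral_cong)
    fix u :: real
    show "indicator {0..} (c * u) * ennreal (2/p * (c * u) powr (1/p - 1)) * ennreal (1 / C * exp (- (c * u) / c)) =
        ennreal (2 / (p * C) * c powr (1/p - 1)) * ennreal (indicator {0..} u * u powr (1/p - 1) / exp u)"
    proof (cases "u \<ge> 0")
      case True
      have "2/p * (c * u) powr (1/p - 1) * (1 / C * exp (- (c * u) / c)) =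
          2 / (p * C) * c powr (1/p - 1) * (u powr (1/p - 1) / exp u)"
        using c True by (simp add: powr_mult exp_minus divide_inverse mult_ac)
      moreover have "0 \<le> 2/p * (c * u) powr (1/p - 1)" "0 \<le> 2 / (p * C) * c powr (1/p - 1)"
        using p C by simp_all
      moreover have "c * u \<ge> 0" using c True by simp
      ultimately show ?thesis
        using True by (simp only: indicator_simps atLeast_iff mult_1 ennreal_mult'[symmetric])
    next
      case False
      then have "\<not> c * u \<ge> 0" using c by (simp add: zero_le_mult_iff)
      then show ?thesis using False by simp
    qed
  qed
  also have "\<dots> = ennreal c * (ennreal (2 / (p * C) * c powr (1/p - 1)) * ennreal (Gamma (1/p)))"
    using p by (subst nn_integral_cmult) (auto simp: Gamma_conv_nn_integral_real)
  also have "\<dots> = ennreal (c * (2 / (p * C) * c powr (1/p - 1) * Gamma (1/p)))"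
    using c C p by (simp add: ennreal_mult'[symmetric])
  also have "c * (2 / (p * C) * c powr (1/p - 1) * Gamma (1/p)) = 1"
  proof -
    have "Gamma (1/p) \<noteq> 0" using p by simp
    \<comment> \<open>Here c^(1/p) = p^(1/p) R, which cancels the same factor in p C = 2 R
      Gamma(1/p) p^(1/p).\<close>
    moreover have "c * c powr (1/p - 1) = p powr (1/p) * R"
      using c p R by (simp add: powr_diff) (simp add: c_def powr_mult powr_powr)
    moreover have "p * p powr (1/p - 1) = p powr (1/p)" using p by (simp add: powr_diff)
    ultimately show ?thesis using p R
      by (simp add: C_def field_simps)
  qed
  finally show ?thesis by simp
qed

lemma borel_measurable_limit_density:
  assumes "b > 0" "a > 0" "even a"
  shows "limit_density a b R \<in> borel_measurable borel"
  unfolding limit_density_def[abs_def] Let_def rat_pow_eq_powr[OF assms] by measurable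

lemma prob_space_limit_density:
  fixes R :: real
  assumes "R > 0" "b > 0" "a > 0" "even a"
  shows "prob_space (density lborel (\<lambda>t. ennreal (limit_density a b R t)))"
  using nn_integral_limit_density[OF assms] borel_measurable_limit_density[OF assms(2-4), of R]
  by (intro prob_spaceI) (simp add: emeasure_density)

text \<open>The density is a product of one-variable densities, so its integral over a box factors.
  Agreement on boxes identifies the law with the product measure.\<close>

lemma limit_law_eq_PiM:
  fixes R :: real
  assumes R: "R > 0" and b: "b > 0" and a: "a > 0" "even a"
  shows "limit_law a b R k = Pi\<^sub>M {1..k} (\<lambda>_. density lborel (\<lambda>t. ennreal (limit_density a b R t)))"
proof -
  let ?f = "\<lambda>t. ennreal (limit_density a b R t)"
  let ?D = "density lborel ?f"
  note [measurable] = borel_measurable_limit_density[OF b a, of R]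
  have f0: "limit_density a b R t \<ge> 0" for t
    using R a b by (auto simp: limit_density_def Let_def intro!: divide_nonneg_nonneg mult_nonneg_nonneg
      less_imp_le[OF Gamma_real_pos])
  interpret D: product_prob_space "\<lambda>_. ?D"
    using prob_space_limit_density[OF assms]
    by (simp add: product_prob_space_def product_sigma_finite_def product_prob_space_axioms_def
      prob_space_imp_sigma_finite)
  interpret product_sigma_finite "\<lambda>_. lborel :: real measure" ..
  show ?thesis
  proof (rule D.PiM_eqI)
    fix A :: "nat \<Rightarrow> real set" assume A: "\<And>j. j \<in> {1..k} \<Longrightarrow> A j \<in> sets ?D"
    have joint[measurable]: "limit_joint_density a b R k \<in> borel_measurable (Pi\<^sub>M {1..k} (\<lambda>_. lborel))"
      unfolding limit_joint_density_eq_prod[OF b a(1), abs_def] by measurable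
    have box: "Pi\<^sub>E {1..k} A \<in> sets (Pi\<^sub>M {1..k} (\<lambda>_. lborel))"
      using A by (intro sets_PiM_I_finite) auto
    have "emeasure (limit_law a b R k) (Pi\<^sub>E {1..k} A) = (\<integral>\<^sup>+x. ennreal (limit_joint_density a b R k x) *
        indicator (Pi\<^sub>E {1..k} A) x \<partial>Pi\<^sub>M {1..k} (\<lambda>_. lborel))"
      unfolding limit_law_def by (rule emeasure_density[OF _ box]) measurable
    also have "\<dots> = (\<integral>\<^sup>+x. (\<Prod>j\<in>{1..k}. ?f (x j) * indicator (A j) (x j)) \<partial>Pi\<^sub>M {1..k} (\<lambda>_. lborel))"
    proof (intro nn_integral_cong)
      fix x assume "x \<in> space (Pi\<^sub>M {1..k} (\<lambda>_. lborel :: real measure))"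
      \<comment> \<open>The indicator of the box factors because points of the space are
        extensional; other functions could satisfy every coordinate condition and still lie outside
        \<open>Pi\<^sub>E\<close>.\<close>
      then have "indicator (Pi\<^sub>E {1..k} A) x = (\<Prod>j\<in>{1..k}. indicator (A j) (x j) :: ennreal)"
        by (auto simp: space_PiM PiE_iff indicator_def)
      then show "ennreal (limit_joint_density a b R k x) * indicator (Pi\<^sub>E {1..k} A) x =
          (\<Prod>j\<in>{1..k}. ?f (x j) * indicator (A j) (x j))"
        by (simp add: limit_joint_density_eq_prod[OF b a(1)] prod.distrib prod_ennreal f0)
    qed
    also have "\<dots> = (\<Prod>j\<in>{1..k}. \<integral>\<^sup>+t. ?f t * indicator (A j) t \<partial>lborel)"
    proof (rule product_nn_integral_prod)
      fix j assume "j \<in> {1..k}"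
      then have [measurable]: "A j \<in> sets borel" using A by simp
      show "(\<lambda>t. ?f t * indicator (A j) t) \<in> borel_measurable lborel" by measurable
    qed simp
    also have "\<dots> = (\<Prod>j\<in>{1..k}. emeasure ?D (A j))"
    proof (rule prod.cong)
      fix j assume "j \<in> {1..k}"
      then have "A j \<in> sets lborel" using A by simp
      then show "(\<integral>\<^sup>+t. ?f t * indicator (A j) t \<partial>lborel) = emeasure ?D (A j)"
        by (intro emeasure_density[symmetric]) auto
    qed simp
    finally show "emeasure (limit_law a b R k) (Pi\<^sub>E {1..k} A) = (\<Prod>j\<in>{1..k}. emeasure ?D (A j))" .
  qed (auto simp: limit_law_def intro!: sets_PiM_cong)
qed

text \<open>Independence means that the joint law of the coordinates is the product of their
  marginals. For a product of probability measures the marginals are the factors.\<close>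

lemma limit_law_indep:
  fixes R :: real
  assumes R: "R > 0" and b: "b > 0" and a: "a > 0" "even a" and k: "1 \<le> k"
  shows "prob_space (limit_law a b R k)"
    and "prob_space.indep_vars (limit_law a b R k) (\<lambda>_. borel) (\<lambda>j x. x j) {1..k}"
proof -
  let ?D = "density lborel (\<lambda>t. ennreal (limit_density a b R t))"
  note [measurable] = borel_measurable_limit_density[OF b a, of R]
  note D = prob_space_limit_density[OF R b a]
  have L: "limit_law a b R k = Pi\<^sub>M {1..k} (\<lambda>_. ?D)" by (rule limit_law_eq_PiM[OF R b a])
  show P: "prob_space (limit_law a b R k)" unfolding L by (intro prob_space_PiM D)
  interpret prob_space "limit_law a b R k" by fact
  show "indep_vars (\<lambda>_. borel) (\<lambda>j x. x j) {1..k}"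
  proof (subst indep_vars_iff_distr_eq_PiM')
    \<comment> \<open>Restricting an extensional function to its own index set changes nothing, so
      the joint law of the coordinates is the limit law itself.\<close>
    have "distr (limit_law a b R k) (Pi\<^sub>M {1..k} (\<lambda>_. borel)) (\<lambda>x. \<lambda>i\<in>{1..k}. x i)
      = distr (limit_law a b R k) (limit_law a b R k) (\<lambda>x. x)"
      unfolding L by (rule distr_cong) (auto simp: space_PiM PiE_def extensional_restrict intro!: sets_PiM_cong)
    also have "\<dots> = Pi\<^sub>M {1..k} (\<lambda>_. ?D)" by (simp add: L)
    also have "\<dots> = Pi\<^sub>M {1..k} (\<lambda>i. distr (limit_law a b R k) borel (\<lambda>x. x i))"
    proof (rule PiM_cong)
      fix i assume i: "i \<in> {1..k}"
      have "?D = distr (Pi\<^sub>M {1..k} (\<lambda>_. ?D)) ?D (\<lambda>x. x i)"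
        using i D by (intro distr_PiM_component[symmetric]) auto
      also have "\<dots> = distr (limit_law a b R k) borel (\<lambda>x. x i)"
        unfolding L by (rule distr_cong) auto
      finally show "?D = distr (limit_law a b R k) borel (\<lambda>x. x i)" .
    qed simp
    finally show "distr (limit_law a b R k) (Pi\<^sub>M {1..k} (\<lambda>_. borel)) (\<lambda>x. \<lambda>i\<in>{1..k}. x i)
      = Pi\<^sub>M {1..k} (\<lambda>i. distr (limit_law a b R k) borel (\<lambda>x. x i))" .
    fix i assume "i \<in> {1..k}"
    then have "(\<lambda>x. x i) \<in> measurable (Pi\<^sub>M {1..k} (\<lambda>_. ?D)) ?D"
      by (rule measurable_component_singleton)
    then show "random_variable borel (\<lambda>x. x i)" unfolding L by simp
  qed (use k in auto)
qed

theorem theorem1: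
  fixes R :: real and p0 q0 :: nat
  assumes "R > 0" and "p0 > 0" and "q0 > 0" and "even p0" and "coprime p0 q0"
    and "real p0 / real q0 \<ge> 1"
  shows
    "(\<forall>n k. k \<in> {1..n} \<longrightarrow>
        distributed (unif_p_ball p0 q0 R n) lborel (\<lambda>x. x k)
          (\<lambda>t. ennreal (coord_density p0 q0 R n t)))
   \<and> (\<forall>t. (\<lambda>n. coord_density p0 q0 R n t) \<longlonglongrightarrow> limit_density p0 q0 R t)
   \<and> (\<forall>n k i. 1 \<le> k \<and> inj_on i {1..k} \<and> i ` {1..k} \<subseteq> {1..n} \<longrightarrow>
        distributed (unif_p_ball p0 q0 R n) (Pi\<^sub>M {1..k} (\<lambda>_. lborel))
          (\<lambda>x. \<lambda>j\<in>{1..k}. x (i j)) (\<lambda>x. ennreal (joint_density p0 q0 R n k x)))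
   \<and> (\<forall>k x. 1 \<le> k \<longrightarrow>
        (\<lambda>n. joint_density p0 q0 R n k x) \<longlonglongrightarrow> limit_joint_density p0 q0 R k x)
   \<and> (\<forall>k x. 1 \<le> k \<longrightarrow>
        limit_joint_density p0 q0 R k x = (\<Prod>j\<in>{1..k}. limit_density p0 q0 R (x j)))
   \<and> (\<forall>k. 1 \<le> k \<longrightarrow>
        prob_space (limit_law p0 q0 R k)
        \<and> prob_space.indep_vars (limit_law p0 q0 R k) (\<lambda>_. borel) (\<lambda>j x. x j) {1..k})"
proof (intro conjI allI impI)
  note p0 = \<open>p0 > 0\<close> \<open>even p0\<close>
  show "distributed (unif_p_ball p0 q0 R n) lborel (\<lambda>x. x k) (\<lambda>t. ennreal (coord_density p0 q0 R n t))"
    if "k \<in> {1..n}" for n k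
    by (rule distributed_coord_density[OF assms(1,3) p0 that])
  show "(\<lambda>n. coord_density p0 q0 R n t) \<longlonglongrightarrow> limit_density p0 q0 R t" for t
    using tendsto_joint_density[OF assms(1,6), of 1 "\<lambda>_. t"]
    by (simp only: joint_density_1 limit_joint_density_1)
  show "distributed (unif_p_ball p0 q0 R n) (Pi\<^sub>M {1..k} (\<lambda>_. lborel))
      (\<lambda>x. \<lambda>j\<in>{1..k}. x (i j)) (\<lambda>x. ennreal (joint_density p0 q0 R n k x))"
    if "1 \<le> k \<and> inj_on i {1..k} \<and> i ` {1..k} \<subseteq> {1..n}" for n k i
    using that by (intro distributed_joint_density[OF assms(1,3) p0]) blast+
  show "(\<lambda>n. joint_density p0 q0 R n k x) \<longlonglongrightarrow> limit_joint_density p0 q0 R k x" for k x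
    by (rule tendsto_joint_density[OF assms(1,6)])
  show "limit_joint_density p0 q0 R k x = (\<Prod>j\<in>{1..k}. limit_density p0 q0 R (x j))" for k x
    by (rule limit_joint_density_eq_prod[OF assms(3,2)])
  fix k :: nat assume k: "1 \<le> k"
  show "prob_space (limit_law p0 q0 R k)"
    "prob_space.indep_vars (limit_law p0 q0 R k) (\<lambda>_. borel) (\<lambda>j x. x j) {1..k}"
    by (rule limit_law_indep[OF assms(1,3) p0 k])+
qed

end
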